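(* Let $\mathcal{M}\subset\mathbb{R}^{2\times2}$ be a convex compact irreducible set, not containing singular matrices, with $\rho(\mathcal{M})=0$. Then the Barabanov balls are strictly convex, i.e. the unit sphere $S=\{x\in\mathbb{R}^2:v(x)=1\}$ of a Barabanov norm $v$ contains no non-trivial segment.
   Context: A switching law is a measurable $A:[0,\infty)\to\mathcal{M}$; a solution of the switched system is an absolutely continuous $x:[0,\infty)\to\mathbb{R}^n$ with $\dot x(t)=A(t)x(t)$ a.e. for some switching law (here $n=2$). $\mathcal{M}$ is irreducible if no nonzero proper subspace of $\mathbb{R}^n$ is invariant under all $A\in\mathcal{M}$. $\rho(\mathcal{M}):=\sup\limsup_{t\to+\infty}\frac1t\log\|x(t)\|$, supremum over all solutions with $x(0)\ne0$. A Barabanov norm is a norm $v$ on $\mathbb{R}^n$ such that (1) $v(x(t))\le v(x(0))$ for every solution $x(\cdot)$ and $t\ge0$; (2) for every $y\in\mathbb{R}^n$ there is a solution $x(\cdot)$ with $x(0)=y$ and $v(x(t))=v(y)$ for all $t\ge0$. Barabanov balls are the balls of a Barabanov norm. *)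

theory Defs
  imports "HOL-Analysis.Analysis"
begin

definition abs_continuous_on_interval :: "(real \<Rightarrow> 'a::real_normed_vector) \<Rightarrow> real \<Rightarrow> real \<Rightarrow> bool" where
  "abs_continuous_on_interval f a b \<longleftrightarrow>
     (\<forall>\<epsilon>>0. \<exists>\<delta>>0. \<forall>D :: (real \<times> real) set.
        finite D \<longrightarrow>
        (\<forall>(u, w)\<in>D. a \<le> u \<and> u < w \<and> w \<le> b) \<longrightarrow>
        pairwise (\<lambda>p q. disjnt {fst p<..<snd p} {fst q<..<snd q}) D \<longrightarrow>
        (\<Sum>(u, w)\<in>D. w - u) < \<delta> \<longrightarrow>
        (\<Sum>(u, w)\<in>D. norm (f w - f u)) < \<epsilon>)"

text \<open>
  On the unbounded half-line, absolute continuity is meant locally, i.e. on every compact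
  subinterval; otherwise exponentially growing solutions would be excluded.
\<close>

definition abs_continuous_halfline :: "(real \<Rightarrow> 'a::real_normed_vector) \<Rightarrow> bool" where
  "abs_continuous_halfline f \<longleftrightarrow> (\<forall>T\<ge>0. abs_continuous_on_interval f 0 T)"

text \<open>Switching laws and trajectories are total functions; their values at negative times play no role.\<close>

definition switching_law :: "(real^'n^'n) set \<Rightarrow> (real \<Rightarrow> real^'n^'n) \<Rightarrow> bool" where
  "switching_law M A \<longleftrightarrow>
     A \<in> borel_measurable (lebesgue_on {0..}) \<and> (\<forall>t\<ge>0. A t \<in> M)"

definition switched_solution :: "(real^'n^'n) set \<Rightarrow> (real \<Rightarrow> real^'n) \<Rightarrow> bool" where
  "switched_solution M x \<longleftrightarrow>
     abs_continuous_halfline x \<and>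
     (\<exists>A. switching_law M A \<and>
       (AE t in lebesgue_on {0..}. (x has_vector_derivative (A t *v x t)) (at t within {0..})))"

definition irreducible_matrices :: "(real^'n^'n) set \<Rightarrow> bool" where
  "irreducible_matrices M \<longleftrightarrow>
     (\<forall>V. subspace V \<and> V \<noteq> {0} \<and> V \<noteq> UNIV \<longrightarrow> \<not> (\<forall>A\<in>M. \<forall>x\<in>V. A *v x \<in> V))"

text \<open>
  For bounded \<open>M\<close>, nonzero solutions never vanish, so the logarithm is always taken of a positive number.
\<close>

definition switched_rho :: "(real^'n^'n) set \<Rightarrow> ereal" where
  "switched_rho M =
     (SUP x\<in>{x. switched_solution M x \<and> x 0 \<noteq> 0}.
        Limsup at_top (\<lambda>t. ereal (ln (norm (x t)) / t)))"

definition norm_function :: "('a::real_vector \<Rightarrow> real) \<Rightarrow> bool" where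
  "norm_function v \<longleftrightarrow>
     (\<forall>x. 0 \<le> v x) \<and>
     (\<forall>x. v x = 0 \<longleftrightarrow> x = 0) \<and>
     (\<forall>c x. v (c *\<^sub>R x) = \<bar>c\<bar> * v x) \<and>
     (\<forall>x y. v (x + y) \<le> v x + v y)"

definition barabanov_norm :: "(real^'n^'n) set \<Rightarrow> (real^'n \<Rightarrow> real) \<Rightarrow> bool" where
  "barabanov_norm M v \<longleftrightarrow>
     norm_function v \<and>
     (\<forall>x. switched_solution M x \<longrightarrow> (\<forall>t\<ge>0. v (x t) \<le> v (x 0))) \<and>
     (\<forall>y. \<exists>x. switched_solution M x \<and> x 0 = y \<and> (\<forall>t\<ge>0. v (x t) = v y))"

end

theory Submission
  imports Defs
begin

text \<open>
  If \<open>v\<close> coincided with a nonzero linear functional \<open>l\<close> on a nonempty open set \<open>U\<close>, then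
  monotonicity of \<open>v\<close> along the solutions with constant switching law \<open>A \<in> M\<close> would give
  \<open>l (A y) \<le> 0\<close> for all \<open>y \<in> U\<close>. A solution with constant \<open>v\<close> starting in \<open>U\<close> supplies some \<open>A\<close>
  and some \<open>z \<in> U\<close> with \<open>l (A z) = 0\<close>, so the linear functional \<open>l \<circ> A\<close> attains a local maximum
  and vanishes, and \<open>A\<close> is singular. In the plane, a segment on the unit sphere makes \<open>v\<close> linear
  on the open cone that it spans.
\<close>

section \<open>Solutions for constant switching laws\<close>

lemma matrix_vector_funpow_bound:
  fixes A :: "real^'n^'n"
  obtains K where "K > 0" "\<And>n y. norm (((*v) A ^^ n) y) \<le> K ^ n * norm y"
proof -
  obtain K where K: "K > 0" "\<And>x. norm (A *v x) \<le> norm x * K"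
    using bounded_linear.pos_bounded[OF matrix_vector_mul_bounded_linear[of A]] by blast
  have "norm (((*v) A ^^ n) y) \<le> K ^ n * norm y" for n y
  proof (induction n)
    case (Suc n)
    have "norm (((*v) A ^^ Suc n) y) \<le> norm (((*v) A ^^ n) y) * K"
      using K(2) by simp
    also have "\<dots> \<le> K ^ n * norm y * K"
      using Suc K(1) by (intro mult_right_mono) auto
    finally show ?case by (simp add: mult_ac)
  qed simp
  with K(1) show thesis by (rule that)
qed

text \<open>The solution is \<open>exp (t A) y\<close>, written as one real power series in
  \<open>t\<close> per coordinate, so that scalar termwise differentiation applies.\<close>

lemma linear_ode_solution_exists:
  fixes A :: "real^'n^'n"
  obtains x where "x 0 = y" "\<And>t. (x has_vector_derivative (A *v x t)) (at t)"
proof -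
  define c where "c i n = (((*v) A ^^ n) y) $ i / fact n" for i n
  define x where "x t = (\<chi> i. \<Sum>n. c i n * t ^ n)" for t
  obtain K where K: "K > 0" "\<And>n y. norm (((*v) A ^^ n) y) \<le> K ^ n * norm y"
    using matrix_vector_funpow_bound[of A] by blast
  \<comment> \<open>The majorant is the exponential series of \<open>K * \<bar>t\<bar>\<close>,
    scaled by \<open>norm y\<close>.\<close>
  have summ: "summable (\<lambda>n. c i n * t ^ n)" for i t
  proof (rule summable_comparison_test')
    show "summable (\<lambda>n. norm y * (inverse (fact n) * (K * \<bar>t\<bar>) ^ n))"
      by (intro summable_mult summable_exp)
    show "norm (c i n * t ^ n) \<le> norm y * (inverse (fact n) * (K * \<bar>t\<bar>) ^ n)" for n
    proof -
      have "\<bar>(((*v) A ^^ n) y) $ i\<bar> \<le> K ^ n * norm y"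
        using K(2)[of n y] component_le_norm_cart order_trans by blast
      then have "\<bar>(((*v) A ^^ n) y) $ i\<bar> * (\<bar>t\<bar> ^ n / fact n) \<le> K ^ n * norm y * (\<bar>t\<bar> ^ n / fact n)"
        by (intro mult_right_mono) auto
      then show ?thesis
        by (simp add: c_def abs_mult power_abs power_mult_distrib field_simps)
    qed
  qed
  \<comment> \<open>The derived coefficient is \<open>(n+1) * c i (n+1)\<close>, where the factor
    \<open>n+1\<close> turns \<open>fact (n+1)\<close> into \<open>fact n\<close>; what remains is
    one more application of \<open>A\<close>.\<close>
  have diffs_c: "diffs (c i) n = (\<Sum>j\<in>UNIV. A $ i $ j * c j n)" for i n
  proof -
    have "diffs (c i) n = (A *v (((*v) A ^^ n) y)) $ i / fact n"
      by (simp add: diffs_def c_def field_simps del: of_nat_Suc)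
    then show ?thesis
      by (simp add: matrix_vector_mult_def c_def sum_divide_distrib)
  qed
  have deriv: "((\<lambda>t. x t $ i) has_real_derivative (A *v x t) $ i) (at t)" for i t
  proof -
    have "((\<lambda>t. \<Sum>n. c i n * t ^ n) has_real_derivative (\<Sum>n. diffs (c i) n * t ^ n)) (at t)"
      \<comment> \<open>Termwise differentiation at \<open>t\<close> needs convergence at some point
        of larger modulus.\<close>
      by (rule termdiffs_strong[of _ "\<bar>t\<bar> + 1"]) (use summ in auto)
    moreover have "(\<Sum>n. diffs (c i) n * t ^ n) = (\<Sum>j\<in>UNIV. A $ i $ j * x t $ j)"
    proof -
      have "(\<Sum>n. diffs (c i) n * t ^ n) = (\<Sum>n. \<Sum>j\<in>UNIV. A $ i $ j * (c j n * t ^ n))"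
        by (simp add: diffs_c sum_distrib_right mult.assoc)
      also have "\<dots> = (\<Sum>j\<in>UNIV. \<Sum>n. A $ i $ j * (c j n * t ^ n))"
        by (rule suminf_sum) (intro summable_mult summ)
      also have "\<dots> = (\<Sum>j\<in>UNIV. A $ i $ j * x t $ j)"
        by (simp add: x_def suminf_mult summ)
      finally show ?thesis .
    qed
    ultimately show ?thesis by (simp add: x_def matrix_vector_mult_def)
  qed
  have "(x has_vector_derivative (A *v x t)) (at t)" for t
    unfolding has_vector_derivative_def has_derivative_componentwise_within[of x]
    using deriv[THEN has_field_derivative_imp_has_derivative]
    by (auto simp: Basis_vec_def inner_axis mult.commute[of _ "_ $ _"] has_field_derivative_def)
  moreover have "x 0 = y"
    unfolding x_def powser_zero by (simp add: c_def vec_eq_iff)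
  ultimately show thesis using that by blast
qed

text \<open>The derivative is bounded on each compact interval, so \<open>x\<close> is Lipschitz
  there by the mean value inequality.\<close>

lemma abs_continuous_halfline_if_C1:
  fixes x :: "real \<Rightarrow> 'a::real_normed_vector"
  assumes deriv: "\<And>t. (x has_vector_derivative x' t) (at t)" and cont: "continuous_on UNIV x'"
  shows "abs_continuous_halfline x"
  unfolding abs_continuous_halfline_def abs_continuous_on_interval_def
proof (intro allI impI)
  fix T \<epsilon> :: real assume "T \<ge> 0" and \<epsilon>: "\<epsilon> > 0"
  have "bounded (x' ` {0..T})"
    by (intro compact_imp_bounded compact_continuous_image continuous_on_subset[OF cont]) auto
  then obtain B where B: "B > 0" "\<And>t. t \<in> {0..T} \<Longrightarrow> norm (x' t) \<le> B"
    unfolding bounded_pos by auto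
  have lip: "norm (x w - x u) \<le> B * (w - u)" if "0 \<le> u" "u < w" "w \<le> T" for u w
  proof -
    have "norm (x w - x u) \<le> B * norm (w - u)"
    proof (rule differentiable_bound[of "{0..T}" x "\<lambda>t h. h *\<^sub>R x' t"])
      show "(x has_derivative (\<lambda>h. h *\<^sub>R x' t)) (at t within {0..T})" for t
        using deriv has_vector_derivative_def has_derivative_at_withinI by blast
      show "onorm (\<lambda>h. h *\<^sub>R x' t) \<le> B" if "t \<in> {0..T}" for t
        using B(2)[OF that] by (intro onorm_le) (simp add: mult.commute[of B] mult_left_mono)
    qed (use that in auto)
    then show ?thesis using that by simp
  qed
  show "\<exists>\<delta>>0. \<forall>D. finite D \<longrightarrow> (\<forall>(u, w)\<in>D. 0 \<le> u \<and> u < w \<and> w \<le> T) \<longrightarrow>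
      pairwise (\<lambda>p q. disjnt {fst p<..<snd p} {fst q<..<snd q}) D \<longrightarrow>
      (\<Sum>(u, w)\<in>D. w - u) < \<delta> \<longrightarrow> (\<Sum>(u, w)\<in>D. norm (x w - x u)) < \<epsilon>"
  proof (intro exI[of _ "\<epsilon> / B"] conjI allI impI)
    show "\<epsilon> / B > 0" using \<epsilon> B by simp
    fix D :: "(real \<times> real) set"
    assume D: "\<forall>(u, w)\<in>D. 0 \<le> u \<and> u < w \<and> w \<le> T" and less: "(\<Sum>(u, w)\<in>D. w - u) < \<epsilon> / B"
    have "(\<Sum>(u, w)\<in>D. norm (x w - x u)) \<le> (\<Sum>(u, w)\<in>D. B * (w - u))"
      by (rule sum_mono) (use D lip in auto)
    also have "\<dots> = B * (\<Sum>(u, w)\<in>D. w - u)"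
      by (simp add: sum_distrib_left case_prod_unfold)
    also have "\<dots> < \<epsilon>"
      using less B(1) by (simp add: field_simps)
    finally show "(\<Sum>(u, w)\<in>D. norm (x w - x u)) < \<epsilon>" .
  qed
qed

text \<open>This makes the monotonicity clause of a Barabanov norm available along
  \<open>exp (t A) y\<close>.\<close>

lemma constant_switching_solution:
  fixes A :: "real^'n^'n"
  assumes "A \<in> M" and deriv: "\<And>t. (x has_vector_derivative (A *v x t)) (at t)"
  shows "switched_solution M x"
  unfolding switched_solution_def
proof (intro conjI exI[of _ "\<lambda>_. A"])
  have "continuous_on UNIV x"
    using deriv has_vector_derivative_continuous continuous_at_imp_continuous_on by blast
  then have "continuous_on UNIV (\<lambda>t. A *v x t)"
    by (rule bounded_linear.continuous_on[OF matrix_vector_mul_bounded_linear])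
  with deriv show "abs_continuous_halfline x"
    by (rule abs_continuous_halfline_if_C1)
  show "switching_law M (\<lambda>_. A)"
    using assms(1) by (simp add: switching_law_def)
  show "AE t in lebesgue_on {0..}. (x has_vector_derivative A *v x t) (at t within {0..})"
    using deriv by (simp add: has_vector_derivative_at_within)
qed

section \<open>Barabanov norms that agree with a linear functional on an open set\<close>

lemma abs_continuous_halfline_near_0:
  fixes x :: "real \<Rightarrow> 'a::real_normed_vector"
  assumes "abs_continuous_halfline x" "open U" "x 0 \<in> U"
  obtains \<delta> where "\<delta> > 0" "\<And>t. 0 \<le> t \<Longrightarrow> t < \<delta> \<Longrightarrow> x t \<in> U"
proof -
  obtain e where e: "e > 0" "\<And>y. dist y (x 0) < e \<Longrightarrow> y \<in> U"
    using assms(2,3) open_dist by metis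
  have "abs_continuous_on_interval x 0 1"
    using assms(1) by (simp add: abs_continuous_halfline_def)
  then obtain \<delta> where \<delta>: "\<delta> > 0" and *: "\<And>D :: (real \<times> real) set. finite D \<Longrightarrow>
        (\<forall>(u, w)\<in>D. 0 \<le> u \<and> u < w \<and> w \<le> 1) \<Longrightarrow>
        pairwise (\<lambda>p q. disjnt {fst p<..<snd p} {fst q<..<snd q}) D \<Longrightarrow>
        (\<Sum>(u, w)\<in>D. w - u) < \<delta> \<Longrightarrow> (\<Sum>(u, w)\<in>D. norm (x w - x u)) < e"
    unfolding abs_continuous_on_interval_def using e(1) by meson
  \<comment> \<open>Absolute continuity on \<open>[0,1]\<close>, tested on the single interval from
    \<open>0\<close> to \<open>t\<close>, is continuity from the right at \<open>0\<close>. The case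
    \<open>t = 0\<close> is separate because the test intervals are nondegenerate.\<close>
  have "x t \<in> U" if "0 \<le> t" "t < min \<delta> 1" for t
  proof (cases "t = 0")
    case False
    then show ?thesis
      using that *[of "{(0, t)}"] by (intro e(2)) (auto simp: dist_norm)
  qed (use assms(3) in simp)
  then show thesis
    using that[of "min \<delta> 1"] \<delta> by simp
qed

text \<open>While the solution with constant law \<open>A\<close> from \<open>y\<close> stays in
  \<open>U\<close>, its \<open>v\<close>-value is \<open>c \<bullet> x t\<close>, which cannot
  exceed its initial value; so the derivative at \<open>0\<close>, which is
  \<open>c \<bullet> (A *v y)\<close>, is not positive.\<close>

lemma barabanov_linear_region_descent:
  fixes A :: "real^'n^'n"
  assumes v: "barabanov_norm M v" and U: "open U" "\<And>x. x \<in> U \<Longrightarrow> v x = c \<bullet> x"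
    and A: "A \<in> M" and y: "y \<in> U"
  shows "c \<bullet> (A *v y) \<le> 0"
proof -
  obtain x where x0: "x 0 = y" and deriv: "\<And>t. (x has_vector_derivative (A *v x t)) (at t)"
    using linear_ode_solution_exists[of y A] by metis
  have sol: "switched_solution M x"
    using A deriv by (rule constant_switching_solution)
  then obtain \<delta> where \<delta>: "\<delta> > 0" "\<And>t. 0 \<le> t \<Longrightarrow> t < \<delta> \<Longrightarrow> x t \<in> U"
    using abs_continuous_halfline_near_0[of x U] U(1) y x0 switched_solution_def by metis
  have le: "c \<bullet> x t \<le> c \<bullet> x 0" if "0 \<le> t" "t < \<delta>" for t
  proof -
    have "v (x t) \<le> v (x 0)"
      using v sol that(1) by (simp add: barabanov_norm_def)
    then show ?thesis
      using U(2) \<delta> that by simp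
  qed
  have "((\<lambda>t. c \<bullet> x t) has_vector_derivative c \<bullet> (A *v x 0)) (at 0)"
    by (rule bounded_linear.has_vector_derivative[OF bounded_linear_inner_right deriv])
  then have der: "((\<lambda>t. c \<bullet> x t) has_real_derivative c \<bullet> (A *v y)) (at 0)"
    by (simp add: has_real_derivative_iff_has_vector_derivative x0)
  show ?thesis
  proof (rule ccontr)
    assume "\<not> c \<bullet> (A *v y) \<le> 0"
    then obtain d where d: "d > 0" "\<And>h. 0 < h \<Longrightarrow> h < d \<Longrightarrow> c \<bullet> x 0 < c \<bullet> x (0 + h)"
      using DERIV_pos_inc_right[OF der] by auto
    obtain h where "0 < h" "h < min d \<delta>"
      using dense[of 0 "min d \<delta>"] d(1) \<delta>(1) by auto
    then show False
      using d(2)[of h] le[of h] by simp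
  qed
qed

text \<open>A solution from \<open>m\<close> with constant \<open>v\<close> stays in
  \<open>U\<close> for a short time, during which \<open>c \<bullet> x t\<close> is constant.
  Differentiating at a time when the equation holds gives \<open>A\<close> and
  \<open>z\<close>.\<close>

lemma barabanov_linear_region_stationary:
  fixes M :: "(real^'n^'n) set"
  assumes v: "barabanov_norm M v" and U: "open U" "\<And>x. x \<in> U \<Longrightarrow> v x = c \<bullet> x"
    and m: "m \<in> U"
  obtains A z where "A \<in> M" "z \<in> U" "c \<bullet> (A *v z) = 0"
proof -
  obtain x where sol: "switched_solution M x" and x0: "x 0 = m"
    and const: "\<And>t. t \<ge> 0 \<Longrightarrow> v (x t) = v m"
    using v unfolding barabanov_norm_def by metis
  obtain \<delta> where \<delta>: "\<delta> > 0" "\<And>t. 0 \<le> t \<Longrightarrow> t < \<delta> \<Longrightarrow> x t \<in> U"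
    using abs_continuous_halfline_near_0[of x U] U(1) m x0 sol switched_solution_def by metis
  obtain A where A: "switching_law M A" and
    ae: "AE t in lebesgue_on {0..}. (x has_vector_derivative (A t *v x t)) (at t within {0..})"
    using sol unfolding switched_solution_def by blast
  have ae': "AE t in lebesgue. t \<in> {0..} \<longrightarrow>
      (x has_vector_derivative (A t *v x t)) (at t within {0..})"
    using ae by (subst (asm) AE_restrict_space_iff) auto
  \<comment> \<open>The equation fails only on a null set, which cannot contain an interval of
    positive length.\<close>
  have "\<exists>t\<in>{0<..<\<delta>}. (x has_vector_derivative (A t *v x t)) (at t within {0..})"
  proof (rule ccontr)
    assume "\<not> ?thesis"
    then have "AE t in lebesgue. t \<notin> {0<..<\<delta>}"
      using ae' by (auto elim!: eventually_mono)
    then have "emeasure lebesgue {0<..<\<delta>} = 0"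
      by (subst (asm) AE_iff_measurable[of "{0<..<\<delta>}"]) auto
    then show False using \<delta>(1) by simp
  qed
  then obtain t where t: "0 < t" "t < \<delta>"
    and "(x has_vector_derivative (A t *v x t)) (at t within {0..})" by auto
  \<comment> \<open>Since \<open>t\<close> is interior to the half-line, the derivative within it is
    a full derivative.\<close>
  then have "(x has_vector_derivative (A t *v x t)) (at t within {0<..<\<delta>})"
    by (rule_tac has_vector_derivative_within_subset) auto
  then have "(x has_vector_derivative (A t *v x t)) (at t)"
    using t by (subst (asm) at_within_open) auto
  then have der: "((\<lambda>t. c \<bullet> x t) has_vector_derivative c \<bullet> (A t *v x t)) (at t)"
    by (rule bounded_linear.has_vector_derivative[OF bounded_linear_inner_right])
  have "((\<lambda>_. v m) has_vector_derivative 0) (at t)"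
    by simp
  then have "((\<lambda>t. c \<bullet> x t) has_vector_derivative 0) (at t)"
  proof (rule has_vector_derivative_transform_within_open)
    show "v m = c \<bullet> x s" if "s \<in> {0<..<\<delta>}" for s
      using that const[of s] U(2)[OF \<delta>(2)[of s]] by simp
  qed (use t in auto)
  with der have "c \<bullet> (A t *v x t) = 0"
    using vector_derivative_unique_at by blast
  then show thesis
    using that[of "A t" "x t"] A t \<delta>(2) by (simp add: switching_law_def)
qed

lemma barabanov_norm_not_locally_linear:
  fixes M :: "(real^'n^'n) set"
  assumes v: "barabanov_norm M v" and inv: "\<forall>A\<in>M. invertible A"
    and U: "open U" "\<And>x. x \<in> U \<Longrightarrow> v x = c \<bullet> x" and "c \<noteq> 0"
  shows "U = {}"
proof (rule ccontr)
  assume "U \<noteq> {}"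
  then obtain A z where A: "A \<in> M" and z: "z \<in> U" and zero: "c \<bullet> (A *v z) = 0"
    using barabanov_linear_region_stationary[OF v U] by blast
  \<comment> \<open>\<open>d\<close> represents the functional that sends \<open>y\<close> to
    \<open>c \<bullet> (A *v y)\<close>: it is at most \<open>0\<close> on \<open>U\<close> and
    vanishes at \<open>z\<close>.\<close>
  define d where "d = c v* A"
  have d: "d \<bullet> y = c \<bullet> (A *v y)" for y
    unfolding d_def by (rule dot_lmul_matrix)
  obtain e where e: "e > 0" "ball z e \<subseteq> U"
    using U(1) z openE by blast
  have "d = 0"
  proof (rule ccontr)
    assume "d \<noteq> 0"
    \<comment> \<open>The step \<open>r *\<^sub>R d\<close> has length \<open>e / 2\<close>, so it
      stays in the ball around \<open>z\<close>, yet it raises the functional from \<open>0\<close>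
      to a positive value.\<close>
    define r where "r = e / (2 * norm d)"
    have r: "r > 0" "r * norm d < e"
      using e(1) \<open>d \<noteq> 0\<close> by (auto simp: r_def)
    then have "z + r *\<^sub>R d \<in> U"
      using e(2) by (auto simp: dist_norm)
    then have "d \<bullet> (z + r *\<^sub>R d) \<le> 0"
      using barabanov_linear_region_descent[OF v U A] d by simp
    moreover have "d \<bullet> (z + r *\<^sub>R d) = r * (d \<bullet> d)"
      using zero by (simp add: inner_add_right d[of z])
    moreover have "r * (d \<bullet> d) > 0"
      using r(1) \<open>d \<noteq> 0\<close> by simp
    ultimately show False by linarith
  qed
  \<comment> \<open>Invertibility of \<open>A\<close> carries \<open>d = 0\<close> over to
    \<open>c = 0\<close>.\<close>
  moreover obtain B where "A ** B = mat 1"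
    using inv A unfolding invertible_def by blast
  then have "c \<bullet> c = d \<bullet> (B *v c)"
    by (simp add: d matrix_vector_mul_assoc)
  ultimately show False
    using \<open>c \<noteq> 0\<close> by simp
qed

section \<open>Segments on the unit sphere in the plane\<close>

lemma unit_sphere_segment_independent:
  fixes a b :: "real^2"
  assumes v: "norm_function v" and "a \<noteq> b" and seg: "closed_segment a b \<subseteq> {x. v x = 1}"
  shows "a$1 * b$2 \<noteq> a$2 * b$1"
proof
  assume D: "a$1 * b$2 = a$2 * b$1"
  have scale: "v (k *\<^sub>R x) = \<bar>k\<bar> * v x" for k x
    using v by (simp add: norm_function_def)
  have v0: "v 0 = 0"
    using v by (simp add: norm_function_def)
  have va: "v a = 1" and vb: "v b = 1"
    using seg by auto
  then have "a \<noteq> 0" using v0 by auto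
  then have "a$1 \<noteq> 0 \<or> a$2 \<noteq> 0"
    by (auto simp: vec_eq_iff forall_2)
  then obtain k where k: "b = k *\<^sub>R a"
  proof
    assume "a$1 \<noteq> 0"
    then show thesis
      using D by (intro that[of "b$1 / a$1"]) (simp add: vec_eq_iff forall_2 field_simps)
  next
    assume "a$2 \<noteq> 0"
    then show thesis
      using D by (intro that[of "b$2 / a$2"]) (simp add: vec_eq_iff forall_2 field_simps)
  qed
  \<comment> \<open>Equal norms leave \<open>k = 1\<close>, excluded by \<open>a \<noteq> b\<close>,
    and \<open>k = -1\<close>, which makes \<open>0\<close> the midpoint of the segment.\<close>
  then have "\<bar>k\<bar> = 1"
    using va vb scale by simp
  with k \<open>a \<noteq> b\<close> have "b = - a"
    by (auto simp: abs_if split: if_splits)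
  then have "0 \<in> closed_segment a b"
    unfolding in_segment by (intro exI[of _ "1/2"]) simp
  then show False using seg v0 by auto
qed

theorem corollary3:
  fixes M :: "(real^2^2) set" and v :: "real^2 \<Rightarrow> real"
  assumes "convex M"
    and "compact M"
    and "irreducible_matrices M"
    and "\<forall>A\<in>M. invertible A"
    and "switched_rho M = 0"
    and "barabanov_norm M v"
  shows "\<not> (\<exists>a b. a \<noteq> b \<and> closed_segment a b \<subseteq> {x. v x = 1})"
proof
  assume "\<exists>a b. a \<noteq> b \<and> closed_segment a b \<subseteq> {x. v x = 1}"
  then obtain a b where "a \<noteq> b" and seg: "closed_segment a b \<subseteq> {x. v x = 1}" by blast
  have v: "norm_function v"
    using assms(6) by (simp add: barabanov_norm_def)
  define D where "D = a$1 * b$2 - a$2 * b$1"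
  have D: "D \<noteq> 0"
    using unit_sphere_segment_independent[OF v \<open>a \<noteq> b\<close> seg] by (simp add: D_def)
  \<comment> \<open>The dual basis of \<open>a, b\<close>, by Cramer's rule.\<close>
  define p q :: "real^2" where "p = vector [b$2 / D, - b$1 / D]" and "q = vector [- a$2 / D, a$1 / D]"
  have dual: "p \<bullet> a = 1" "p \<bullet> b = 0" "q \<bullet> a = 0" "q \<bullet> b = 1"
    using D by (auto simp: p_def q_def inner_vec_def sum_2 field_simps) (auto simp: D_def field_simps)
  have expand: "x = (p \<bullet> x) *\<^sub>R a + (q \<bullet> x) *\<^sub>R b" for x
    using D by (auto simp: p_def q_def inner_vec_def sum_2 vec_eq_iff forall_2 field_simps)
      (auto simp: D_def algebra_simps)
  \<comment> \<open>As \<open>p\<close> and \<open>q\<close> read off the coordinates in the basis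
    \<open>a\<close>, \<open>b\<close>, this is the open cone spanned by the segment.\<close>
  define U where "U = {x. p \<bullet> x > 0} \<inter> {x. q \<bullet> x > 0}"
  have "open U"
    unfolding U_def by (intro open_Int open_halfspace_gt)
  moreover have "v x = (p + q) \<bullet> x" if "x \<in> U" for x
  proof -
    \<comment> \<open>Dividing \<open>x\<close> by its coordinate sum \<open>s\<close> projects it
      radially to a point \<open>y\<close> of the segment, where \<open>v\<close> is
      \<open>1\<close>; homogeneity then gives \<open>v x = s\<close>.\<close>
    define s where "s = p \<bullet> x + q \<bullet> x"
    define y where "y = (1 - q \<bullet> x / s) *\<^sub>R a + (q \<bullet> x / s) *\<^sub>R b"
    have pos: "p \<bullet> x > 0" "q \<bullet> x > 0" "s > 0"
      using that by (auto simp: U_def s_def)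
    then have "y \<in> closed_segment a b"
      unfolding y_def in_segment by (intro exI[of _ "q \<bullet> x / s"]) (auto simp: s_def)
    then have "v y = 1" using seg by auto
    have "s *\<^sub>R y = (s - q \<bullet> x) *\<^sub>R a + (q \<bullet> x) *\<^sub>R b"
      using pos by (simp add: y_def scaleR_add_right right_diff_distrib)
    also have "\<dots> = x"
      using expand[of x] by (simp add: s_def)
    finally have "v x = \<bar>s\<bar> * v y"
      using v by (metis norm_function_def)
    with \<open>v y = 1\<close> pos show ?thesis
      by (simp add: s_def inner_add_left)
  qed
  \<comment> \<open>The functional takes the value \<open>1\<close> at \<open>a\<close>.\<close>
  moreover have "p + q \<noteq> 0"
    using dual by (metis add.right_neutral inner_add_left inner_zero_left zero_neq_one)
  ultimately have "U = {}"
    by (rule barabanov_norm_not_locally_linear[OF assms(6,4)])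
  moreover have "a + b \<in> U"
    using dual by (simp add: U_def inner_add_right)
  ultimately show False by blast
qed

end
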